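(* Let $G$ be a finite bipartite graph with partition classes $X$ and $Y$, and let $k>0$. If $\tau$ is a tangle of $\vec S_{4k}(X)$, then $\tau' := {}^{\triangleright}\tau\cap \vec S_k(Y)$ is a tangle of $\vec S_k(Y)$.
   Context: Let $G$ be a finite (simple) bipartite graph with partition classes $X$ and $Y$; $N(v)$ denotes the set of neighbours of a vertex $v$. Separations: for $Z\in\{X,Y\}$, $\vec S(Z)$ is the set of all oriented separations of $Z$, i.e. ordered pairs $(A,B)$ of subsets of $Z$ with $A\cup B=Z$ (the sets $A,B$ may intersect and may be empty). The inverse of $(A,B)$ is $(B,A)$. Order functions: for $(A,B)\in\vec S(X)$, $$|A,B|_X:=\sum_{y\in Y}\Big(\min\{|N(y)\cap A|,|N(y)\cap B|\}-\tfrac12|N(y)\cap A\cap B|\Big),$$ and for $(C,D)\in\vec S(Y)$, $|C,D|_Y$ is defined in the same way with the roles of $X$ and $Y$ exchanged. For a real number $k>0$, $\vec S_k(X)$ is the set of $(A,B)\in\vec S(X)$ with $|A,B|_X<k$; similarly $\vec S_k(Y)$. Standing assumption: whenever a set $\vec S_k(X)$ (resp. $\vec S_k(Y)$) is considered, $k$ is assumed to be such that $(X,X)\notin\vec S_k(X)$ (resp. $(Y,Y)\notin\vec S_k(Y)$). Shift: for $(C,D)\in\vec S(Y)$ let $(C,D)^\triangleleft:=(C_D^\triangleleft,D_C^\triangleleft)\in\vec S(X)$, where $C_D^\triangleleft=\{x\in X: |N(x)\cap C|\ge|N(x)\cap D|\}$ and $D_C^\triangleleft=\{x\in X: |N(x)\cap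 C|\le|N(x)\cap D|\}$. Pull-back: for $\tau\subseteq\vec S(X)$, ${}^{\triangleright}\tau:=\{(C,D)\in\vec S(Y): (C,D)^\triangleleft\in\tau\}$. Tangles: for $Z\in\{X,Y\}$, an orientation of $\vec S_k(Z)$ is a subset of $\vec S_k(Z)$ containing exactly one of $(A,B)$ and $(B,A)$ for every $(A,B)\in\vec S_k(Z)$. A tangle of $\vec S_k(Z)$ is an orientation $\tau$ of $\vec S_k(Z)$ such that there are no (not necessarily distinct) $(A_1,B_1),(A_2,B_2),(A_3,B_3)\in\tau$ with $A_1\cup A_2\cup A_3=Z$. *)

theory Defs
  imports Complex_Main
begin

text \<open>Edges are two-element vertex sets, so that the graph is simple.\<close>

definition finite_bipartite_graph :: "'a set \<Rightarrow> 'a set \<Rightarrow> 'a set set \<Rightarrow> bool" where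
  "finite_bipartite_graph X Y E \<longleftrightarrow>
     finite X \<and> finite Y \<and> X \<inter> Y = {} \<and> (\<forall>e\<in>E. \<exists>x\<in>X. \<exists>y\<in>Y. e = {x, y})"

definition neighbours :: "'a set set \<Rightarrow> 'a \<Rightarrow> 'a set" where
  "neighbours E v = {w. {v, w} \<in> E}"

definition oriented_seps :: "'a set \<Rightarrow> ('a set \<times> 'a set) set" where
  "oriented_seps Z = {(A, B). A \<subseteq> Z \<and> B \<subseteq> Z \<and> A \<union> B = Z}"

text \<open>The order of a separation of one partition class is a sum over the other class \<open>W\<close>:
  \<open>|A,B|\<^sub>X\<close> is \<open>sep_order E Y (A, B)\<close> and \<open>|C,D|\<^sub>Y\<close> is \<open>sep_order E X (C, D)\<close>.\<close>

definition sep_order :: "'a set set \<Rightarrow> 'a set \<Rightarrow> 'a set \<times> 'a set \<Rightarrow> real" where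
  "sep_order E W = (\<lambda>(A, B). \<Sum>w\<in>W.
     min (real (card (neighbours E w \<inter> A))) (real (card (neighbours E w \<inter> B)))
       - 1 / 2 * real (card (neighbours E w \<inter> A \<inter> B)))"

text \<open>The oriented separations of \<open>Z\<close> of order less than \<open>k\<close>, where \<open>W\<close> is the partition
  class other than \<open>Z\<close>.\<close>

definition seps_below ::
    "'a set set \<Rightarrow> 'a set \<Rightarrow> 'a set \<Rightarrow> real \<Rightarrow> ('a set \<times> 'a set) set" where
  "seps_below E Z W k = {s \<in> oriented_seps Z. sep_order E W s < k}"

definition shift :: "'a set set \<Rightarrow> 'a set \<Rightarrow> 'a set \<times> 'a set \<Rightarrow> 'a set \<times> 'a set" where
  "shift E X = (\<lambda>(C, D).
     ({x \<in> X. card (neighbours E x \<inter> C) \<ge> card (neighbours E x \<inter> D)},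
      {x \<in> X. card (neighbours E x \<inter> C) \<le> card (neighbours E x \<inter> D)}))"

definition pull_back ::
    "'a set set \<Rightarrow> 'a set \<Rightarrow> 'a set \<Rightarrow> ('a set \<times> 'a set) set \<Rightarrow> ('a set \<times> 'a set) set" where
  "pull_back E X Y \<tau> = {s \<in> oriented_seps Y. shift E X s \<in> \<tau>}"

text \<open>``Exactly one'' refers to the elements of the set \<open>{(A, B), (B, A)}\<close>, which is a
  singleton if \<open>A = B\<close>.\<close>

definition orientation_of :: "('a set \<times> 'a set) set \<Rightarrow> ('a set \<times> 'a set) set \<Rightarrow> bool" where
  "orientation_of S \<tau> \<longleftrightarrow>
     \<tau> \<subseteq> S \<and> (\<forall>(A, B)\<in>S. \<exists>!s. s \<in> {(A, B), (B, A)} \<and> s \<in> \<tau>)"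

definition tangle_of ::
    "'a set \<Rightarrow> ('a set \<times> 'a set) set \<Rightarrow> ('a set \<times> 'a set) set \<Rightarrow> bool" where
  "tangle_of Z S \<tau> \<longleftrightarrow> orientation_of S \<tau> \<and>
     \<not> (\<exists>A\<^sub>1 B\<^sub>1 A\<^sub>2 B\<^sub>2 A\<^sub>3 B\<^sub>3. (A\<^sub>1, B\<^sub>1) \<in> \<tau> \<and> (A\<^sub>2, B\<^sub>2) \<in> \<tau> \<and> (A\<^sub>3, B\<^sub>3) \<in> \<tau> \<and>
          A\<^sub>1 \<union> A\<^sub>2 \<union> A\<^sub>3 = Z)"

end

theory Submission
  imports Defs
begin

text \<open>Encode a separation \<open>(A, B)\<close> by its sign vector \<open>1\<^sub>A - 1\<^sub>B\<close>. Twice the order of a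
  separation with sign vector \<open>f\<close> is the minimum, over all \<open>g\<close> with values in \<open>[-1, 1]\<close> on the
  opposite side, of \<open>\<Sum>(1 - f x * g y)\<close> over the edges \<open>xy\<close>; the sign vector of the shift
  attains it. So shifting does not increase the order, which makes \<open>\<tau>'\<close> an orientation.
  Suppose the sets \<open>C\<^sub>i\<close> cover \<open>Y\<close>, and let \<open>L\<close> be the set of the vertices missed by the
  three shifted sets \<open>A\<^sub>i\<close>. Every edge at \<open>L\<close> contributes at least \<open>1\<close> to the three sums
  together, which is all that it contributes for the separation \<open>(A\<^sub>1 \<union> L, B\<^sub>1)\<close>, whose sign
  vanishes on \<open>L\<close>. So this separation has order less than \<open>3k\<close>, but neither of its orientations
  is compatible with \<open>\<tau>\<close>.\<close>

text \<open>A real weight on all pairs of vertices turns a sum over edges into a double sum over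
  both classes, whose order of summation can be exchanged.\<close>

definition adjacency :: "'a set set \<Rightarrow> 'a \<Rightarrow> 'a \<Rightarrow> real" where
  "adjacency E v w = of_bool ({v, w} \<in> E)"

definition sep_sign :: "'a set \<times> 'a set \<Rightarrow> 'a \<Rightarrow> real" where
  "sep_sign = (\<lambda>(A, B) z. of_bool (z \<in> A) - of_bool (z \<in> B))"

lemma adjacency_commute: "adjacency E v w = adjacency E w v"
  by (simp add: adjacency_def insert_commute)

lemma adjacency_nonneg [simp]: "0 \<le> adjacency E v w"
  by (simp add: adjacency_def)

lemma abs_sep_sign_le: "\<bar>sep_sign s z\<bar> \<le> 1"
  by (auto simp: sep_sign_def split: prod.split)

lemma abs_mult_le_one:
  fixes a b :: real
  assumes "\<bar>a\<bar> \<le> 1" "\<bar>b\<bar> \<le> 1"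
  shows "\<bar>a * b\<bar> \<le> 1"
  using mult_mono[of "\<bar>a\<bar>" 1 "\<bar>b\<bar>" 1] assms by (simp add: abs_mult)

lemma card_neighbours_Int:
  assumes "finite Z" "neighbours E v \<subseteq> Z"
  shows "real (card (neighbours E v \<inter> A)) = (\<Sum>z\<in>Z. adjacency E v z * of_bool (z \<in> A))"
proof -
  have "(\<Sum>z\<in>Z. adjacency E v z * of_bool (z \<in> A)) = (\<Sum>z\<in>Z. of_bool (z \<in> neighbours E v \<inter> A))"
    by (intro sum.cong) (auto simp: adjacency_def neighbours_def)
  also have "\<dots> = real (card (Z \<inter> (neighbours E v \<inter> A)))"
    using assms(1) by (simp add: sum_of_bool_eq Int_def)
  also have "Z \<inter> (neighbours E v \<inter> A) = neighbours E v \<inter> A"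
    using assms(2) by blast
  finally show ?thesis by simp
qed

lemma card_neighbours_diff:
  assumes "finite Z" "neighbours E v \<subseteq> Z"
  shows "real (card (neighbours E v \<inter> A)) - real (card (neighbours E v \<inter> B))
         = (\<Sum>z\<in>Z. adjacency E v z * sep_sign (A, B) z)"
  by (simp add: card_neighbours_Int[OF assms] sep_sign_def right_diff_distrib sum_subtractf)

text \<open>As \<open>A\<close> and \<open>B\<close> cover \<open>Z\<close>, the degree of
  \<open>w\<close> is \<open>a + b - m\<close>, where \<open>a\<close>, \<open>b\<close>,
  \<open>m\<close> count its neighbours in \<open>A\<close>, \<open>B\<close> and
  \<open>A \<inter> B\<close>. Since \<open>2 * min a b = a + b - \<bar>a - b\<bar>\<close>,
  doubling the summand of the order leaves the degree minus \<open>\<bar>a - b\<bar>\<close>; the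
  correction by half of \<open>m\<close> is what makes this exact.\<close>

lemma sep_order_eq:
  assumes "finite Z" "\<forall>w\<in>W. neighbours E w \<subseteq> Z" "s \<in> oriented_seps Z"
  shows "2 * sep_order E W s = (\<Sum>w\<in>W. (\<Sum>z\<in>Z. adjacency E w z)
           - \<bar>\<Sum>z\<in>Z. adjacency E w z * sep_sign s z\<bar>)"
proof -
  obtain A B where s: "s = (A, B)" by (cases s)
  have *: "2 * (min (real (card (neighbours E w \<inter> A))) (real (card (neighbours E w \<inter> B)))
       - 1 / 2 * real (card (neighbours E w \<inter> A \<inter> B)))
     = (\<Sum>z\<in>Z. adjacency E w z) - \<bar>\<Sum>z\<in>Z. adjacency E w z * sep_sign s z\<bar>" if "w \<in> W" for w
  proof -
    note N = assms(1) bspec[OF assms(2) that]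
    have "(\<Sum>z\<in>Z. adjacency E w z) = (\<Sum>z\<in>Z. adjacency E w z * of_bool (z \<in> A)
        + adjacency E w z * of_bool (z \<in> B) - adjacency E w z * of_bool (z \<in> A \<inter> B))"
      using assms(3) s by (intro sum.cong) (auto simp: oriented_seps_def)
    also have "\<dots> = real (card (neighbours E w \<inter> A)) + real (card (neighbours E w \<inter> B))
        - real (card (neighbours E w \<inter> (A \<inter> B)))"
      by (simp only: card_neighbours_Int[OF N] sum.distrib sum_subtractf)
    finally show ?thesis
      using card_neighbours_diff[OF N, of A B] by (simp add: s Int_assoc min_def abs_if)
  qed
  have "2 * sep_order E W s = (\<Sum>w\<in>W. 2 * (min (real (card (neighbours E w \<inter> A)))
      (real (card (neighbours E w \<inter> B))) - 1 / 2 * real (card (neighbours E w \<inter> A \<inter> B))))"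
    unfolding s sep_order_def prod.case sum_distrib_left ..
  also have "\<dots> = (\<Sum>w\<in>W. (\<Sum>z\<in>Z. adjacency E w z)
      - \<bar>\<Sum>z\<in>Z. adjacency E w z * sep_sign s z\<bar>)"
    using * by (rule sum.cong[OF refl])
  finally show ?thesis .
qed

text \<open>Each \<open>\<bar>h\<bar>\<close> is at least \<open>g w * h\<close>. The freedom in
  \<open>g\<close> allows a separation to be tested against a vector that does not come from its own
  shift.\<close>

lemma sep_order_le:
  assumes "finite Z" "\<forall>w\<in>W. neighbours E w \<subseteq> Z" "s \<in> oriented_seps Z"
    and g: "\<And>w. w \<in> W \<Longrightarrow> \<bar>g w\<bar> \<le> 1"
  shows "2 * sep_order E W s \<le> (\<Sum>w\<in>W. \<Sum>z\<in>Z. adjacency E w z * (1 - g w * sep_sign s z))"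
  unfolding sep_order_eq[OF assms(1-3)]
proof (rule sum_mono)
  fix w assume w: "w \<in> W"
  let ?h = "\<Sum>z\<in>Z. adjacency E w z * sep_sign s z"
  have "g w * ?h \<le> \<bar>g w\<bar> * \<bar>?h\<bar>"
    by (metis abs_ge_self abs_mult)
  also have "\<dots> \<le> \<bar>?h\<bar>"
    using mult_right_mono[OF g[OF w], of "\<bar>?h\<bar>"] by simp
  finally have "g w * ?h \<le> \<bar>?h\<bar>" .
  moreover have "(\<Sum>z\<in>Z. adjacency E w z * (1 - g w * sep_sign s z))
      = (\<Sum>z\<in>Z. adjacency E w z) - g w * ?h"
    by (simp add: right_diff_distrib sum_subtractf sum_distrib_left mult_ac)
  ultimately show "(\<Sum>z\<in>Z. adjacency E w z) - \<bar>?h\<bar>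
      \<le> (\<Sum>z\<in>Z. adjacency E w z * (1 - g w * sep_sign s z))"
    by simp
qed

text \<open>The shift places \<open>w\<close> by majority among its neighbours, so its sign at
  \<open>w\<close> is the sign of the inner sum \<open>h\<close>, and their product is
  \<open>\<bar>h\<bar>\<close>. A tie puts \<open>w\<close> on both sides, which gives sign 0 and
  matches \<open>h = 0\<close>.\<close>

lemma sep_order_shift_eq:
  assumes "finite Z" "\<forall>w\<in>W. neighbours E w \<subseteq> Z" "s \<in> oriented_seps Z"
  shows "2 * sep_order E W s
         = (\<Sum>w\<in>W. \<Sum>z\<in>Z. adjacency E w z * (1 - sep_sign (shift E W s) w * sep_sign s z))"
  unfolding sep_order_eq[OF assms]
proof (rule sum.cong[OF refl])
  fix w assume w: "w \<in> W"
  let ?h = "\<Sum>z\<in>Z. adjacency E w z * sep_sign s z"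
  obtain C D where s: "s = (C, D)" by (cases s)
  have "sep_sign (shift E W s) w * ?h = \<bar>?h\<bar>"
    using card_neighbours_diff[OF assms(1) bspec[OF assms(2) w], of C D, symmetric] w
    by (auto simp: s shift_def sep_sign_def)
  then show "(\<Sum>z\<in>Z. adjacency E w z) - \<bar>?h\<bar>
      = (\<Sum>z\<in>Z. adjacency E w z * (1 - sep_sign (shift E W s) w * sep_sign s z))"
    by (simp add: right_diff_distrib sum_subtractf sum_distrib_left mult_ac)
qed

lemma shift_in_oriented_seps: "shift E X s \<in> oriented_seps X"
  by (auto simp: shift_def oriented_seps_def split: prod.split)

lemma shift_swap: "shift E X (D, C) = prod.swap (shift E X (C, D))"
  by (simp add: shift_def)

lemma finite_bipartite_graph_neighbours:
  assumes "finite_bipartite_graph X Y E"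
  shows "\<forall>x\<in>X. neighbours E x \<subseteq> Y" "\<forall>y\<in>Y. neighbours E y \<subseteq> X"
  using assms by (fastforce simp: finite_bipartite_graph_def neighbours_def doubleton_eq_iff)+

text \<open>The double sum is symmetric in the two sign vectors: with the sign of \<open>s\<close>
  as test vector it bounds the order of the shift, and summed in the other order it is exactly twice
  the order of \<open>s\<close>.\<close>

lemma sep_order_shift_le:
  assumes "finite_bipartite_graph X Y E" "s \<in> oriented_seps Y"
  shows "sep_order E Y (shift E X s) \<le> sep_order E X s"
proof -
  have fin: "finite X" "finite Y" using assms(1) by (auto simp: finite_bipartite_graph_def)
  note N = finite_bipartite_graph_neighbours[OF assms(1)]
  have "2 * sep_order E Y (shift E X s) \<le> (\<Sum>y\<in>Y. \<Sum>x\<in>X. adjacency E y x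
      * (1 - sep_sign s y * sep_sign (shift E X s) x))"
    by (rule sep_order_le[OF fin(1) N(2) shift_in_oriented_seps abs_sep_sign_le])
  also have "\<dots> = (\<Sum>x\<in>X. \<Sum>y\<in>Y. adjacency E x y
      * (1 - sep_sign (shift E X s) x * sep_sign s y))"
    by (subst sum.swap) (simp add: adjacency_commute mult.commute)
  also have "\<dots> = 2 * sep_order E X s"
    by (rule sep_order_shift_eq[OF fin(2) N(1) assms(2), symmetric])
  finally show ?thesis by simp
qed

lemma tangle_of_not_cover:
  assumes "tangle_of Z S \<tau>" "(A, B) \<in> \<tau>" "(A', B') \<in> \<tau>" "(A'', B'') \<in> \<tau>"
  shows "A \<union> A' \<union> A'' \<noteq> Z"
  using assms unfolding tangle_of_def by blast

lemma tangle_of_cases: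
  assumes "tangle_of Z S \<tau>" "(A, B) \<in> S"
  obtains "(A, B) \<in> \<tau>" | "(B, A) \<in> \<tau>"
  using assms unfolding tangle_of_def orientation_of_def by fastforce

lemma sep_order_insert_middle_less:
  assumes G: "finite_bipartite_graph X Y E"
    and s: "s\<^sub>1 \<in> oriented_seps Y" "s\<^sub>2 \<in> oriented_seps Y" "s\<^sub>3 \<in> oriented_seps Y"
    and less: "sep_order E X s\<^sub>1 < k" "sep_order E X s\<^sub>2 < k" "sep_order E X s\<^sub>3 < k"
    and cover: "fst s\<^sub>1 \<union> fst s\<^sub>2 \<union> fst s\<^sub>3 = Y"
    and AB: "shift E X s\<^sub>1 = (A, B)"
    and L: "L = X - (A \<union> fst (shift E X s\<^sub>2) \<union> fst (shift E X s\<^sub>3))"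
  shows "sep_order E Y (A \<union> L, B) < 3 * k"
proof -
  have fin: "finite X" "finite Y" using G by (auto simp: finite_bipartite_graph_def)
  note N = finite_bipartite_graph_neighbours[OF G]
  define c where "c s x y = 1 - sep_sign (shift E X s) x * sep_sign s y" for s x y
  define \<Phi> where "\<Phi> s = (\<Sum>x\<in>X. \<Sum>y\<in>Y. adjacency E x y * c s x y)" for s
  have \<Phi>: "2 * sep_order E X s = \<Phi> s" if "s \<in> oriented_seps Y" for s
    unfolding \<Phi>_def c_def by (rule sep_order_shift_eq[OF fin(2) N(1) that])
  have c_nonneg: "0 \<le> c s x y" for s x y
    using abs_mult_le_one[OF abs_sep_sign_le abs_sep_sign_le, of "shift E X s" x s y]
    by (simp add: c_def abs_le_iff)
  have AX: "A \<subseteq> X" "B \<subseteq> X" "A \<union> B = X"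
    using shift_in_oriented_seps[of E X s\<^sub>1] AB by (auto simp: oriented_seps_def)
  have sep: "(A \<union> L, B) \<in> oriented_seps X"
    using AX L by (auto simp: oriented_seps_def)
  have neg: "sep_sign (shift E X s) x = -1" if "x \<in> X" "x \<notin> fst (shift E X s)" for s x
    using shift_in_oriented_seps[of E X s] that
    by (cases "shift E X s") (auto simp: oriented_seps_def sep_sign_def)
  have nonneg: "0 \<le> sep_sign s y" if "y \<in> fst s" for s :: "'a set \<times> 'a set" and y
    using that by (cases s) (auto simp: sep_sign_def)
  \<comment> \<open>The test vector is the sign of \<open>s\<^sub>1\<close>. Outside
    \<open>L\<close> the sign of the new separation is that of the shift of
    \<open>s\<^sub>1\<close>, so the term for \<open>s\<^sub>1\<close> alone suffices.\<close>
  have edge: "1 - sep_sign s\<^sub>1 y * sep_sign (A \<union> L, B) x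
      \<le> c s\<^sub>1 x y + c s\<^sub>2 x y + c s\<^sub>3 x y"
    if "x \<in> X" "y \<in> Y" for x y
  proof (cases "x \<in> L")
    case False
    then have "1 - sep_sign s\<^sub>1 y * sep_sign (A \<union> L, B) x = c s\<^sub>1 x y"
      by (simp add: c_def AB sep_sign_def)
    then show ?thesis
      using c_nonneg[of s\<^sub>1 x y] c_nonneg[of s\<^sub>2 x y] c_nonneg[of s\<^sub>3 x y] by simp
  next
    \<comment> \<open>All three shifts have sign -1 at \<open>x\<close>. By the covering,
      \<open>y\<close> lies in the first set of some \<open>s\<^sub>i\<close>, where the sign is 0
      or 1, so that term is at least 1.\<close>
    case True
    then have c: "c s\<^sub>1 x y = 1 + sep_sign s\<^sub>1 y" "c s\<^sub>2 x y = 1 + sep_sign s\<^sub>2 y"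
        "c s\<^sub>3 x y = 1 + sep_sign s\<^sub>3 y"
      using neg[of x s\<^sub>1] neg[of x s\<^sub>2] neg[of x s\<^sub>3] \<open>x \<in> X\<close> L AB by (auto simp: c_def)
    have "sep_sign (A \<union> L, B) x = 0"
      using True AX \<open>x \<in> X\<close> L by (auto simp: sep_sign_def)
    moreover have "1 \<le> c s\<^sub>1 x y + c s\<^sub>2 x y + c s\<^sub>3 x y"
    proof -
      have "y \<in> fst s\<^sub>1 \<or> y \<in> fst s\<^sub>2 \<or> y \<in> fst s\<^sub>3"
        using cover \<open>y \<in> Y\<close> by blast
      then show ?thesis
        using nonneg[of y s\<^sub>1] nonneg[of y s\<^sub>2] nonneg[of y s\<^sub>3]
          c_nonneg[of s\<^sub>1 x y] c_nonneg[of s\<^sub>2 x y] c_nonneg[of s\<^sub>3 x y]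
        unfolding c by linarith
    qed
    ultimately show ?thesis by simp
  qed
  have "2 * sep_order E Y (A \<union> L, B)
      \<le> (\<Sum>y\<in>Y. \<Sum>x\<in>X. adjacency E y x * (1 - sep_sign s\<^sub>1 y * sep_sign (A \<union> L, B) x))"
    by (rule sep_order_le[OF fin(1) N(2) sep abs_sep_sign_le])
  also have "\<dots> \<le> (\<Sum>y\<in>Y. \<Sum>x\<in>X. adjacency E y x * (c s\<^sub>1 x y + c s\<^sub>2 x y + c s\<^sub>3 x y))"
    by (intro sum_mono mult_left_mono edge adjacency_nonneg)
  also have "\<dots> = \<Phi> s\<^sub>1 + \<Phi> s\<^sub>2 + \<Phi> s\<^sub>3"
    unfolding \<Phi>_def by (subst sum.swap) (simp add: adjacency_commute distrib_left sum.distrib)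
  also have "\<dots> = 2 * (sep_order E X s\<^sub>1 + sep_order E X s\<^sub>2 + sep_order E X s\<^sub>3)"
    using s by (simp add: \<Phi>[symmetric])
  finally show ?thesis using less by simp
qed

theorem theorem4p4:
  fixes X Y :: "'a set" and E :: "'a set set" and k :: real
    and \<tau> :: "('a set \<times> 'a set) set"
  assumes "finite_bipartite_graph X Y E"
    and "k > 0"
    and "(X, X) \<notin> seps_below E X Y (4 * k)"
    and "(Y, Y) \<notin> seps_below E Y X k"
    and "tangle_of X (seps_below E X Y (4 * k)) \<tau>"
  shows "tangle_of Y (seps_below E Y X k) (pull_back E X Y \<tau> \<inter> seps_below E Y X k)"
proof -
  let ?S = "seps_below E X Y (4 * k)" and ?T = "seps_below E Y X k"
  let ?\<tau>' = "pull_back E X Y \<tau> \<inter> ?T"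
  note tangle = assms(5)
  have S: "\<exists>!s. s \<in> {(A, B), (B, A)} \<and> s \<in> \<tau>" if "(A, B) \<in> ?S" for A B
  proof -
    have "\<forall>(A, B)\<in>?S. \<exists>!s. s \<in> {(A, B), (B, A)} \<and> s \<in> \<tau>"
      using tangle unfolding tangle_of_def orientation_of_def by (elim conjE)
    from bspec[OF this that] show ?thesis by (simp only: prod.case)
  qed
  have shift_below: "shift E X s \<in> ?S" if "s \<in> ?T" for s
    using sep_order_shift_le[OF assms(1), of s] shift_in_oriented_seps[of E X s] that \<open>k > 0\<close>
    by (auto simp: seps_below_def)
  have swap_below: "(D, C) \<in> ?T" if "(C, D) \<in> ?T" for C D
    using that by (simp add: seps_below_def oriented_seps_def sep_order_def min.commute
      Int_ac Un_commute)
  have pull: "s \<in> ?\<tau>' \<longleftrightarrow> s \<in> ?T \<and> shift E X s \<in> \<tau>" for s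
    by (auto simp: pull_back_def seps_below_def)
  have "orientation_of ?T ?\<tau>'"
    unfolding orientation_of_def
  proof (intro conjI ballI, goal_cases)
    case (2 s)
    obtain C D where s: "s = (C, D)" by (cases s)
    obtain A B where AB: "shift E X (C, D) = (A, B)"
      by (cases "shift E X (C, D)")
    have BA: "shift E X (D, C) = (B, A)"
      using AB shift_swap[of E X D C] by simp
    have "(A, B) \<in> ?S"
      using shift_below[of s] 2 s AB by simp
    then have ex1: "\<exists>!t. t \<in> {(A, B), (B, A)} \<and> t \<in> \<tau>" by (rule S)
    \<comment> \<open>For a self-inverse pair, "exactly one" would not exclude either orientation.
      Such a pair would be \<open>(X, X)\<close>, whose order is too large by assumption.\<close>
    have "(A, B) \<noteq> (B, A)"
    proof
      assume "(A, B) = (B, A)"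
      moreover have "A \<union> B = X"
        using \<open>(A, B) \<in> ?S\<close> by (simp add: seps_below_def oriented_seps_def)
      ultimately have "(A, B) = (X, X)" by blast
      then show False using \<open>(A, B) \<in> ?S\<close> assms(3) by simp
    qed
    then have "((A, B) \<in> \<tau>) \<noteq> ((B, A) \<in> \<tau>)"
      using ex1 by blast
    \<comment> \<open>Shifting commutes with inversion, so the exclusive choice in
      \<open>\<tau>\<close> pulls back.\<close>
    then have "((C, D) \<in> ?\<tau>') \<noteq> ((D, C) \<in> ?\<tau>')"
      using 2 s swap_below unfolding pull AB BA by blast
    then show ?case unfolding s prod.case by blast
  qed simp
  moreover have False
    if "(C\<^sub>1, D\<^sub>1) \<in> ?\<tau>'" "(C\<^sub>2, D\<^sub>2) \<in> ?\<tau>'" "(C\<^sub>3, D\<^sub>3) \<in> ?\<tau>'"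
      and cover: "C\<^sub>1 \<union> C\<^sub>2 \<union> C\<^sub>3 = Y" for C\<^sub>1 D\<^sub>1 C\<^sub>2 D\<^sub>2 C\<^sub>3 D\<^sub>3
  proof -
    obtain A\<^sub>1 B\<^sub>1 A\<^sub>2 B\<^sub>2 A\<^sub>3 B\<^sub>3 where A: "shift E X (C\<^sub>1, D\<^sub>1) = (A\<^sub>1, B\<^sub>1)"
        "shift E X (C\<^sub>2, D\<^sub>2) = (A\<^sub>2, B\<^sub>2)" "shift E X (C\<^sub>3, D\<^sub>3) = (A\<^sub>3, B\<^sub>3)"
      by (meson surj_pair)
    have \<tau>: "(A\<^sub>1, B\<^sub>1) \<in> \<tau>" "(A\<^sub>2, B\<^sub>2) \<in> \<tau>" "(A\<^sub>3, B\<^sub>3) \<in> \<tau>"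
      using that(1-3) unfolding pull A by auto
    have AX: "A\<^sub>1 \<union> B\<^sub>1 = X" "A\<^sub>2 \<subseteq> X" "A\<^sub>3 \<subseteq> X"
      using shift_in_oriented_seps[of E X "(C\<^sub>1, D\<^sub>1)"] shift_in_oriented_seps[of E X "(C\<^sub>2, D\<^sub>2)"]
        shift_in_oriented_seps[of E X "(C\<^sub>3, D\<^sub>3)"]
      unfolding A by (simp_all add: oriented_seps_def)
    define L where "L = X - (A\<^sub>1 \<union> A\<^sub>2 \<union> A\<^sub>3)"
    have "sep_order E Y (A\<^sub>1 \<union> L, B\<^sub>1) < 3 * k"
      using that A
      by (intro sep_order_insert_middle_less[OF assms(1),
            where s\<^sub>1 = "(C\<^sub>1, D\<^sub>1)" and s\<^sub>2 = "(C\<^sub>2, D\<^sub>2)" and s\<^sub>3 = "(C\<^sub>3, D\<^sub>3)"])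
        (simp_all add: seps_below_def L_def)
    moreover have "(A\<^sub>1 \<union> L, B\<^sub>1) \<in> oriented_seps X"
      using AX by (auto simp: oriented_seps_def L_def)
    \<comment> \<open>The bound \<open>3 * k\<close> is below \<open>4 * k\<close> because
      \<open>k\<close> is positive, so \<open>\<tau>\<close> must orient this separation.\<close>
    ultimately have "(A\<^sub>1 \<union> L, B\<^sub>1) \<in> ?S"
      using \<open>k > 0\<close> by (simp add: seps_below_def)
    then consider (left) "(A\<^sub>1 \<union> L, B\<^sub>1) \<in> \<tau>" | (right) "(B\<^sub>1, A\<^sub>1 \<union> L) \<in> \<tau>"
      using tangle_of_cases[OF tangle] by blast
    then show False
    proof cases
      \<comment> \<open>By the choice of \<open>L\<close>, the sets
        \<open>A\<^sub>1 \<union> L\<close>, \<open>A\<^sub>2\<close>, \<open>A\<^sub>3\<close>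
        cover \<open>X\<close>.\<close>
      case left
      then show False
        using tangle_of_not_cover[OF tangle left \<tau>(2,3)] AX by (auto simp: L_def)
    next
      \<comment> \<open>Here \<open>A\<^sub>1\<close> and \<open>B\<^sub>1\<close> already cover
        \<open>X\<close>; the triple repeats one separation.\<close>
      case right
      then show False
        using tangle_of_not_cover[OF tangle \<tau>(1) right right] AX by auto
    qed
  qed
  ultimately show ?thesis
    unfolding tangle_of_def by blast
qed

end
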